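(* Let $d\ge 1$ and let $G$ be a graph with $n\ge d+2$ vertices. The set of Gstressable frameworks of $G$ in $\mathbb{R}^d$ is dense, in the standard (Euclidean) topology of the configuration space $(\mathbb{R}^d)^n$, in the set of Fstressable frameworks of $G$ in $\mathbb{R}^d$.
   Context: Graphs are finite and simple, with vertex set $\{1,\dots,n\}$. A framework $(G,p)$ in $\mathbb{R}^d$ is the graph $G$ with a configuration $p=(p_1,\dots,p_n)$ of points of $\mathbb{R}^d$. The configuration $p$ is in affine general position if no $k\le d+1$ of its points lie on a $(k-2)$-dimensional affine subspace. An equilibrium stress matrix of $(G,p)$ is a real symmetric $n\times n$ matrix $\Omega$ with $\Omega_{ij}=0$ whenever $i\neq j$ and $\{i,j\}$ is not an edge, with the all-ones vector in its kernel, and with $\sum_j\Omega_{ij}p_j=0$ for all $i$. $(G,p)$ is Gstressable if $p$ is in affine general position and $(G,p)$ has an equilibrium stress matrix of rank $n-d-1$. $(G,p)$ is Fstressable if $(G,p)$ has an equilibrium stress matrix of rank $n-d-1$ and, for each vertex $i$, the points $p_i$ and $p_j$ ($j$ ranging over the neighbors of $i$) together have a full $d$-dimensional affine span. *)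

theory Defs
  imports "HOL-Analysis.Analysis"
begin

text \<open>
  The vertex set is the finite type \<open>'n\<close>, with \<open>n = CARD('n)\<close>; the ambient space is \<open>real^'d\<close>,
  with \<open>d = CARD('d)\<close> (at least 1, since types are nonempty).
  A graph is given by its set of edges, each edge being a two-element set of vertices, and a
  configuration is an element of \<open>real^'d^'n\<close>, whose norm is the Euclidean norm on \<open>d * n\<close> coordinates.
\<close>

definition simple_graph :: "'n set set \<Rightarrow> bool" where
  "simple_graph E \<longleftrightarrow> (\<forall>e\<in>E. card e = 2)"

text \<open>
  The quantifier runs over sets of vertices rather than sets of positions, so that coinciding
  points count separately. For \<open>card K \<le> 1\<close> the condition holds trivially, because the only affine
  set of negative dimension is the empty set, of dimension \<open>-1\<close>.
\<close>

definition affine_general_position :: "real^'d^'n \<Rightarrow> bool" where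
  "affine_general_position p \<longleftrightarrow>
     (\<forall>K :: 'n set. card K \<le> CARD('d) + 1 \<longrightarrow>
        \<not> (\<exists>A :: (real^'d) set. affine A \<and> aff_dim A = int (card K) - 2 \<and> (\<forall>i\<in>K. p $ i \<in> A)))"

definition equilibrium_stress_matrix :: "'n set set \<Rightarrow> real^'d^'n \<Rightarrow> real^'n^'n \<Rightarrow> bool" where
  "equilibrium_stress_matrix E p \<Omega> \<longleftrightarrow>
     transpose \<Omega> = \<Omega> \<and>
     (\<forall>i j. i \<noteq> j \<and> {i, j} \<notin> E \<longrightarrow> \<Omega> $ i $ j = 0) \<and>
     \<Omega> *v (\<chi> i. 1) = 0 \<and>
     (\<forall>i. (\<Sum>j\<in>UNIV. (\<Omega> $ i $ j) *\<^sub>R (p $ j)) = 0)"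

text \<open>Rank \<open>n - d - 1\<close>, written additively to avoid truncated subtraction.\<close>

definition has_max_rank_stress :: "'n set set \<Rightarrow> real^'d^'n \<Rightarrow> bool" where
  "has_max_rank_stress E p \<longleftrightarrow>
     (\<exists>\<Omega>. equilibrium_stress_matrix E p \<Omega> \<and> rank \<Omega> + CARD('d) + 1 = CARD('n))"

definition Gstressable :: "'n set set \<Rightarrow> real^'d^'n \<Rightarrow> bool" where
  "Gstressable E p \<longleftrightarrow> affine_general_position p \<and> has_max_rank_stress E p"

definition Fstressable :: "'n set set \<Rightarrow> real^'d^'n \<Rightarrow> bool" where
  "Fstressable E p \<longleftrightarrow>
     has_max_rank_stress E p \<and>
     (\<forall>i. aff_dim (affine hull (insert (p $ i) {p $ j |j. {i, j} \<in> E})) = int CARD('d))"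

definition dense_in :: "'a::topological_space set \<Rightarrow> 'a set \<Rightarrow> bool" where
  "dense_in A B \<longleftrightarrow> A \<subseteq> B \<and> B \<subseteq> closure A"

end

theory Submission
  imports Defs
begin

text \<open>
  Let \<open>\<Omega>\<close> be a stress of rank \<open>r = n - d - 1\<close> for an Fstressable \<open>p\<close>. The columns \<open>v\<^sub>i\<close> of a matrix
  \<open>V\<close> near the identity have Gram matrix \<open>V\<^sup>T \<Omega> V\<close> with respect to \<open>\<Omega>\<close>; if it vanishes at the
  non-edges, then \<open>V\<^sup>-\<^sup>1\<close> carries the kernel of \<open>\<Omega>\<close> to that of a nearby stress of the same rank, and
  hence \<open>p\<close> to a nearby configuration. That configuration is in general position as soon as all
  \<open>r \<times> r\<close> principal minors of the Gram matrix are nonzero.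

  By Gale duality the span condition on \<open>p\<close> says that for every vertex the vectors at its
  non-neighbours are independent modulo the kernel of \<open>\<Omega>\<close>. Therefore a small perturbation of some
  of the \<open>v\<^sub>i\<close> that respects the orthogonality relations among them extends to all vertices, by solving
  at each further vertex a linear system whose rows stay independent. A principal
  minor is made nonzero by adding its vertices one at a time: once the minor on \<open>L\<close> is nonzero and
  \<open>card L < r\<close>, the vectors orthogonal to \<open>v\<^sub>l\<close> (\<open>l \<in> L\<close>) contain an anisotropic \<open>w\<close>, and moving
  \<open>v\<^sub>j\<close> along \<open>w\<close> changes the Schur complement by a nonzero quadratic polynomial.

  Conversely, if a vertex of a Gstressable framework violates the span condition, general position
  forces its row of \<open>\<Omega>\<close> to vanish, so its indicator vector is an affine function of the positions
  and all the other points lie on a hyperplane.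
\<close>

subsection \<open>Perturbation of linear systems\<close>

text \<open>The coordinate subspace indexed by \<open>L\<close>. It stays inside
  \<open>real^'n\<close>, so that principal submatrices need no index type of their own.\<close>

definition supported_on :: "'n set \<Rightarrow> (real^'n) set" where
  "supported_on L = {x. \<forall>i. i \<notin> L \<longrightarrow> x $ i = 0}"

lemma supported_on_iff: "x \<in> supported_on L \<longleftrightarrow> (\<forall>i. i \<notin> L \<longrightarrow> x $ i = 0)"
  by (simp add: supported_on_def)

lemma subspace_supported_on: "subspace (supported_on L)"
  by (auto simp: subspace_def supported_on_iff)

lemma norm_matrix_vector_mult_le:
  fixes A :: "real^'n^'m"
  shows "norm (A *v x) \<le> norm A * norm x"
proof -
  have "norm (A *v x) \<le> L2_set (\<lambda>i. norm (A $ i) * norm x) UNIV"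
    unfolding norm_vec_def[of "A *v x"]
    by (rule L2_set_mono) (auto simp: matrix_vector_mul_component Cauchy_Schwarz_ineq2)
  also have "\<dots> = norm A * norm x"
    by (simp add: norm_vec_def[of A] L2_set_left_distrib)
  finally show ?thesis .
qed

lemma tendsto_matrix_matrix_mult:
  fixes A :: "real^'n^'m" and B :: "real^'k^'n"
  assumes "(f \<longlongrightarrow> A) F" "(g \<longlongrightarrow> B) F"
  shows "((\<lambda>x. f x ** g x) \<longlongrightarrow> A ** B) F"
  unfolding matrix_matrix_mult_def
  by (intro tendsto_vec_lambda tendsto_sum tendsto_mult tendsto_vec_nth assms)

lemma tendsto_transpose:
  fixes A :: "real^'n^'m"
  assumes "(f \<longlongrightarrow> A) F"
  shows "((\<lambda>x. transpose (f x)) \<longlongrightarrow> transpose A) F"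
  unfolding transpose_def by (intro tendsto_vec_lambda tendsto_vec_nth assms)

text \<open>A linear map that is injective on a subspace is bounded below there by some
  \<open>e\<close>. A perturbation of norm less than \<open>e/2\<close> costs at most half of this
  bound, so \<open>e/2\<close> serves both as radius and as new bound.\<close>

lemma matrix_injective_on_perturb:
  fixes A :: "real^'n^'m"
  assumes "subspace S" "\<And>x. x \<in> S \<Longrightarrow> A *v x = 0 \<Longrightarrow> x = 0"
  obtains m where "m > 0"
    "\<And>A' x. dist A' A < m \<Longrightarrow> x \<in> S \<Longrightarrow> m * norm x \<le> norm (A' *v x)"
proof -
  obtain e where e: "e > 0" "\<And>x. x \<in> S \<Longrightarrow> e * norm x \<le> norm (A *v x)"
    using injective_imp_isometric[OF closed_subspace[OF assms(1)] assms(1) matrix_vector_mul_bounded_linear[of A]] assms(2)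
    by auto
  show thesis
  proof (rule that[of "e/2"])
    fix A' x assume A': "dist A' A < e/2" and x: "x \<in> S"
    have "norm (A *v x) \<le> norm (A' *v x) + norm ((A - A') *v x)"
      by (metis add.commute diff_add_cancel matrix_vector_mult_diff_rdistrib norm_triangle_ineq)
    also have "norm ((A - A') *v x) \<le> norm (A - A') * norm x"
      by (rule norm_matrix_vector_mult_le)
    also have "\<dots> \<le> e/2 * norm x"
      using A' by (intro mult_right_mono) (auto simp: dist_norm norm_minus_commute)
    finally show "e/2 * norm x \<le> norm (A' *v x)"
      using e(2)[OF x] by simp
  qed (use e in auto)
qed

lemma open_matrix_injective_on:
  fixes S :: "(real^'n) set"
  assumes "subspace S"
  shows "open {A :: real^'n^'m. \<forall>x\<in>S. A *v x = 0 \<longrightarrow> x = 0}"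
  unfolding open_dist
proof safe
  fix A :: "real^'n^'m" assume "\<forall>x\<in>S. A *v x = 0 \<longrightarrow> x = 0"
  then obtain m where m: "m > 0"
    "\<And>A' x. dist A' A < m \<Longrightarrow> x \<in> S \<Longrightarrow> m * norm x \<le> norm (A' *v x)"
    using matrix_injective_on_perturb[OF assms, of A] by metis
  have "x = 0" if "dist A' A < m" "x \<in> S" "A' *v x = 0" for A' x
    using m(2)[OF that(1,2)] m(1) that(3) by (simp add: mult_le_0_iff)
  then show "\<exists>e>0. \<forall>A'. dist A' A < e \<longrightarrow> A' \<in> {A. \<forall>x\<in>S. A *v x = 0 \<longrightarrow> x = 0}"
    using m(1) by blast
qed

text \<open>Take \<open>z k\<close> to be \<open>v\<close> minus its orthogonal projection onto the
  image of \<open>S\<close> under \<open>B k\<close>. The lower bound for \<open>B k\<close> on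
  \<open>S\<close>, uniform for large \<open>k\<close>, keeps these images from gaining directions
  in the limit, which gives convergence to \<open>v\<close>.\<close>

lemma orthogonal_perturb:
  fixes A :: "real^'n^'m"
  assumes S: "subspace S" and inj: "\<And>x. x \<in> S \<Longrightarrow> A *v x = 0 \<Longrightarrow> x = 0"
    and orth: "\<And>x. x \<in> S \<Longrightarrow> v \<bullet> (A *v x) = 0"
    and lim: "B \<longlonglongrightarrow> A"
  obtains z where "z \<longlonglongrightarrow> v" "\<And>k x. x \<in> S \<Longrightarrow> z k \<bullet> (B k *v x) = 0"
proof -
  have "\<exists>x z. x \<in> S \<and> v = B k *v x + z \<and> (\<forall>y\<in>S. z \<bullet> (B k *v y) = 0)" for k
  proof -
    have span: "span ((*v) (B k) ` S) = (*v) (B k) ` S"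
      by (simp add: S linear_subspace_image span_eq_iff)
    obtain y z where "y \<in> span ((*v) (B k) ` S)" "v = y + z"
      "\<And>w. w \<in> span ((*v) (B k) ` S) \<Longrightarrow> orthogonal z w"
      using orthogonal_subspace_decomp_exists[of "(*v) (B k) ` S" v] by blast
    then show ?thesis
      unfolding span orthogonal_def by blast
  qed
  then obtain x z where x: "\<And>k. x k \<in> S" and v: "\<And>k. v = B k *v x k + z k"
    and z: "\<And>k y. y \<in> S \<Longrightarrow> z k \<bullet> (B k *v y) = 0"
    by metis
  obtain m where m: "m > 0"
    "\<And>A' x. dist A' A < m \<Longrightarrow> x \<in> S \<Longrightarrow> m * norm x \<le> norm (A' *v x)"
    using matrix_injective_on_perturb[OF S, of A] inj by metis
  have bound: "norm (v - z k) \<le> norm (B k - A) * (norm v / m)" if k: "dist (B k) A < m" for k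
  proof (cases "v - z k = 0")
    case True
    then show ?thesis using m(1) by simp
  next
    case False
    define w where "w = B k *v x k"
    have w: "w = v - z k"
      using v[of k] by (simp add: w_def algebra_simps)
    have nx: "norm (x k) \<le> norm w / m"
      using m(2)[OF k x] m(1) by (simp add: w_def field_simps)
    \<comment> \<open>Since \<open>v\<close> is orthogonal to the image of \<open>S\<close> under
      \<open>A\<close>, only the difference \<open>B k - A\<close> contributes to the projection
      \<open>w\<close>. Dividing by \<open>norm w\<close> gives the bound.\<close>
    have "norm w * norm w = w \<bullet> w"
      by (simp add: dot_square_norm power2_eq_square)
    also have "\<dots> = v \<bullet> (B k *v x k)"
      using z[OF x, of k k] w by (simp add: inner_diff_left flip: w_def)
    also have "\<dots> = v \<bullet> ((B k - A) *v x k)"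
      using orth[OF x, of k] by (simp add: matrix_vector_mult_diff_rdistrib inner_diff_right)
    also have "\<dots> \<le> norm v * norm ((B k - A) *v x k)"
      by (rule norm_cauchy_schwarz)
    also have "\<dots> \<le> norm v * (norm (B k - A) * (norm w / m))"
      by (intro mult_left_mono order_trans[OF norm_matrix_vector_mult_le] nx) auto
    finally have "norm w * norm w \<le> norm w * (norm (B k - A) * (norm v / m))"
      by (simp add: mult_ac)
    moreover have "norm w > 0"
      using False w by simp
    ultimately have "norm w \<le> norm (B k - A) * (norm v / m)"
      by (rule mult_left_le_imp_le)
    then show ?thesis
      by (simp only: w)
  qed
  have "(\<lambda>k. v - z k) \<longlonglongrightarrow> 0"
  proof (rule tendsto_0_le[where K = 1])
    show "(\<lambda>k. norm (B k - A) * (norm v / m)) \<longlonglongrightarrow> 0"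
      by (rule tendsto_mult_left_zero[OF tendsto_norm_zero[OF LIM_zero[OF lim]]])
    have "eventually (\<lambda>k. dist (B k) A < m) sequentially"
      using lim m(1) by (rule tendstoD)
    then show "eventually (\<lambda>k. norm (v - z k) \<le> norm (norm (B k - A) * (norm v / m)) * 1) sequentially"
      by eventually_elim (use bound m(1) in auto)
  qed
  then have "z \<longlonglongrightarrow> v"
    using LIM_zero_cancel tendsto_minus[of "\<lambda>k. v - z k" 0 sequentially] by fastforce
  with z that show thesis by blast
qed

text \<open>The identity \<open>y - x k = (V k - mat 1) *v x k\<close> first bounds
  \<open>x k\<close> by \<open>2 * norm y\<close> once \<open>V k\<close> is within 1/2 of the
  identity, and then forces the difference to 0.\<close>

lemma tendsto_solution_mat_1:
  fixes V :: "nat \<Rightarrow> real^'n^'n"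
  assumes lim: "V \<longlonglongrightarrow> mat 1" and sol: "\<And>k. V k *v x k = y"
  shows "x \<longlonglongrightarrow> y"
proof -
  have bound: "norm (y - x k) \<le> norm (V k - mat 1) * (2 * norm y)" if k: "norm (V k - mat 1) < 1/2" for k
  proof -
    have eq: "y - x k = (V k - mat 1) *v x k"
      by (simp add: sol matrix_vector_mult_diff_rdistrib)
    have le: "norm (y - x k) \<le> norm (V k - mat 1) * norm (x k)"
      unfolding eq by (rule norm_matrix_vector_mult_le)
    also have "\<dots> \<le> 1/2 * norm (x k)"
      using k by (intro mult_right_mono) auto
    finally have "norm (x k) \<le> 2 * norm y"
      using norm_triangle_ineq2[of "x k" y] by (simp add: norm_minus_commute)
    with le show ?thesis
      by (meson mult_left_mono norm_ge_zero order_trans)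
  qed
  have "(\<lambda>k. y - x k) \<longlonglongrightarrow> 0"
  proof (rule tendsto_0_le[where K = 1])
    show "(\<lambda>k. norm (V k - mat 1) * (2 * norm y)) \<longlonglongrightarrow> 0"
      by (rule tendsto_mult_left_zero[OF tendsto_norm_zero[OF LIM_zero[OF lim]]])
    have "eventually (\<lambda>k. dist (V k) (mat 1) < 1/2) sequentially"
      using lim by (rule tendstoD) simp
    then show "eventually (\<lambda>k. norm (y - x k) \<le> norm (norm (V k - mat 1) * (2 * norm y)) * 1) sequentially"
      by eventually_elim (use bound in \<open>auto simp: dist_norm\<close>)
  qed
  then show ?thesis
    using LIM_zero_cancel tendsto_minus[of "\<lambda>k. y - x k" 0 sequentially] by fastforce
qed

subsection \<open>Orthogonal representations with respect to a symmetric form\<close>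

text \<open>\<open>N\<close> plays the role of non-adjacency of distinct vertices. Positions do not
  enter; only the possibly indefinite form given by \<open>\<Omega>\<close> matters.\<close>

locale stress_form =
  fixes \<Omega> :: "real^'n^'n" and N :: "'n \<Rightarrow> 'n \<Rightarrow> bool"
  assumes transpose_\<Omega>: "transpose \<Omega> = \<Omega>"
    and N_sym: "N i j \<Longrightarrow> N j i" and N_irrefl: "\<not> N i i"
begin

definition gram :: "real^'n^'n \<Rightarrow> real^'n^'n" where
  "gram V = transpose V ** \<Omega> ** V"

text \<open>An orthogonal representation of the graph induced on \<open>L\<close>, with the columns
  of \<open>V\<close> as vertex vectors and \<open>\<Omega>\<close> as the form.\<close>

definition orth_on :: "'n set \<Rightarrow> real^'n^'n \<Rightarrow> bool" where
  "orth_on L V \<longleftrightarrow> (\<forall>i\<in>L. \<forall>j\<in>L. N i j \<longrightarrow> gram V $ i $ j = 0)"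

text \<open>Local general position: for each vertex, the vectors of its non-neighbours are linearly
  independent modulo the kernel of \<open>\<Omega>\<close>.\<close>

definition local_gp :: "real^'n^'n \<Rightarrow> bool" where
  "local_gp V \<longleftrightarrow> (\<forall>i. \<forall>x\<in>supported_on {j. N i j}. (\<Omega> ** V) *v x = 0 \<longrightarrow> x = 0)"

text \<open>The principal minor of the Gram matrix on \<open>L\<close> is nonzero, phrased through a
  trivial kernel instead of a determinant.\<close>

definition nonsing_on :: "'n set \<Rightarrow> real^'n^'n \<Rightarrow> bool" where
  "nonsing_on L V \<longleftrightarrow> (\<forall>x\<in>supported_on L. (\<forall>i\<in>L. (gram V *v x) $ i = 0) \<longrightarrow> x = 0)"

lemma form_sym: "x \<bullet> (\<Omega> *v y) = y \<bullet> (\<Omega> *v x)"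
  by (metis dot_lmul_matrix inner_commute transpose_\<Omega> transpose_matrix_vector)

lemma gram_mult_nth: "(gram V *v x) $ i = column i V \<bullet> (\<Omega> *v (V *v x))"
  unfolding gram_def
  by (simp add: column_def row_def transpose_def matrix_vector_mul_component
      flip: matrix_vector_mul_assoc)

lemma gram_nth: "gram V $ i $ j = column i V \<bullet> (\<Omega> *v column j V)"
  using gram_mult_nth[of V "axis j 1" i] by (simp add: matrix_vector_mult_basis) (simp add: column_def)

lemma gram_sym: "gram V $ i $ j = gram V $ j $ i"
  by (simp add: gram_nth form_sym)

lemma tendsto_gram: "(f \<longlongrightarrow> V) F \<Longrightarrow> ((\<lambda>x. gram (f x)) \<longlongrightarrow> gram V) F"
  unfolding gram_def
  by (intro tendsto_matrix_matrix_mult tendsto_transpose tendsto_const)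

lemma open_local_gp: "open {V. local_gp V}"
proof -
  have "open {V. \<forall>x\<in>supported_on {j. N i j}. (\<Omega> ** V) *v x = 0 \<longrightarrow> x = 0}" for i
  proof -
    have "continuous_on UNIV (\<lambda>V. \<Omega> ** V)"
      unfolding continuous_on_def
      by (intro ballI tendsto_matrix_matrix_mult tendsto_const tendsto_ident_at)
    from open_vimage[OF open_matrix_injective_on[OF subspace_supported_on] this]
    show ?thesis by (simp add: vimage_def)
  qed
  then have "open (\<Inter>i\<in>UNIV. {V. \<forall>x\<in>supported_on {j. N i j}. (\<Omega> ** V) *v x = 0 \<longrightarrow> x = 0})"
    by (intro open_INT) auto
  moreover have "(\<Inter>i\<in>UNIV. {V. \<forall>x\<in>supported_on {j. N i j}. (\<Omega> ** V) *v x = 0 \<longrightarrow> x = 0}) = {V. local_gp V}"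
    by (auto simp: local_gp_def)
  ultimately show ?thesis by simp
qed

lemma open_nonsing_on: "open {V. nonsing_on L V}"
proof -
  \<comment> \<open>Clearing the rows outside \<open>L\<close> turns the condition into injectivity
    on a subspace of a matrix that depends continuously on \<open>V\<close>.\<close>
  define F where "F V = (\<chi> i j. if i \<in> L then gram V $ i $ j else 0)" for V
  have F: "(F V *v x) $ i = (if i \<in> L then (gram V *v x) $ i else 0)" for V x i
    by (simp add: F_def matrix_vector_mult_def)
  have "continuous_on UNIV F"
    unfolding continuous_on_def F_def
    by (intro ballI tendsto_vec_lambda) (auto intro!: tendsto_vec_nth tendsto_gram)
  from open_vimage[OF open_matrix_injective_on[OF subspace_supported_on[of L]] this]
  have "open {V. \<forall>x\<in>supported_on L. F V *v x = 0 \<longrightarrow> x = 0}"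
    by (simp add: vimage_def)
  moreover have "F V *v x = 0 \<longleftrightarrow> (\<forall>i\<in>L. (gram V *v x) $ i = 0)" for V x
    by (auto simp: vec_eq_iff F)
  ultimately show ?thesis
    by (simp add: nonsing_on_def)
qed

definition set_column :: "'n \<Rightarrow> real^'n \<Rightarrow> real^'n^'n \<Rightarrow> real^'n^'n" where
  "set_column j w V = (\<chi> i k. if k = j then w $ i else V $ i $ k)"

lemma column_set_column: "column k (set_column j w V) = (if k = j then w else column k V)"
  by (simp add: set_column_def column_def vec_eq_iff)

lemma set_column_column [simp]: "set_column j (column j V) V = V"
  by (simp add: set_column_def column_def vec_eq_iff)

lemma tendsto_set_column:
  assumes "(f \<longlongrightarrow> w) F" "(g \<longlongrightarrow> V) F"
  shows "((\<lambda>x. set_column j (f x) (g x)) \<longlongrightarrow> set_column j w V) F"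
  unfolding set_column_def
  by (intro tendsto_vec_lambda) (auto intro!: tendsto_vec_nth assms)

section \<open>Extending a partial perturbation to all vertices\<close>

text \<open>Column \<open>j\<close> is corrected to be orthogonal to the vectors of all
  non-neighbours of \<open>j\<close>, inside \<open>L\<close> or not. Local general position at
  \<open>V\<close> makes this system stable, so \<open>orthogonal_perturb\<close> gives a solution
  close to the old column.\<close>

lemma extend_step:
  assumes lim: "U \<longlonglongrightarrow> V" and V: "orth_on UNIV V" "local_gp V"
    and L: "\<And>k. orth_on L (U k)"
  obtains U' where "U' \<longlonglongrightarrow> V" "\<And>k. orth_on (insert j L) (U' k)"
    "\<And>k i. i \<noteq> j \<Longrightarrow> column i (U' k) = column i (U k)"
proof -
  define S where "S = supported_on {l. N j l}"
  have 1: "x = 0" if "x \<in> S" "(\<Omega> ** V) *v x = 0" for x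
    using V(2) that unfolding local_gp_def S_def by blast
  have 2: "column j V \<bullet> ((\<Omega> ** V) *v x) = 0" if "x \<in> S" for x
  proof -
    have "column j V \<bullet> ((\<Omega> ** V) *v x) = (gram V *v x) $ j"
      by (simp add: gram_mult_nth matrix_vector_mul_assoc)
    also have "\<dots> = (\<Sum>l\<in>UNIV. gram V $ j $ l * x $ l)"
      by (simp add: matrix_vector_mult_def)
    also have "\<dots> = 0"
    proof (intro sum.neutral ballI)
      fix l
      show "gram V $ j $ l * x $ l = 0"
        using V(1) that unfolding orth_on_def S_def supported_on_iff by (cases "N j l") auto
    qed
    finally show ?thesis .
  qed
  have 3: "(\<lambda>k. \<Omega> ** U k) \<longlonglongrightarrow> \<Omega> ** V"
    by (intro tendsto_matrix_matrix_mult tendsto_const lim)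
  obtain z where z: "z \<longlonglongrightarrow> column j V" "\<And>k x. x \<in> S \<Longrightarrow> z k \<bullet> ((\<Omega> ** U k) *v x) = 0"
    using orthogonal_perturb[OF _ 1 2 3] subspace_supported_on unfolding S_def by blast
  show thesis
  proof
    show "(\<lambda>k. set_column j (z k) (U k)) \<longlonglongrightarrow> V"
      using tendsto_set_column[OF z(1) lim, of j] by simp
    fix k
    have *: "z k \<bullet> (\<Omega> *v column l (U k)) = 0" if "N j l" for l
    proof -
      have "axis l 1 \<in> S"
        using that by (auto simp: S_def supported_on_iff axis_def)
      from z(2)[OF this, of k] have "z k \<bullet> (\<Omega> *v (U k *v axis l 1)) = 0"
        by (simp only: matrix_vector_mul_assoc)
      then show ?thesis
        by (simp only: matrix_vector_mult_basis)
    qed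
    show "orth_on (insert j L) (set_column j (z k) (U k))"
      unfolding orth_on_def
    proof (intro ballI impI)
      fix a b assume ab: "a \<in> insert j L" "b \<in> insert j L" "N a b"
      consider "a = j" "b \<noteq> j" | "a \<noteq> j" "b = j" | "a \<noteq> j" "b \<noteq> j"
        using ab(3) N_irrefl by blast
      then show "gram (set_column j (z k) (U k)) $ a $ b = 0"
      proof cases
        case 1
        then show ?thesis using * ab(3) by (simp add: gram_nth column_set_column)
      next
        case 2
        then show ?thesis using *[of a] N_sym[OF ab(3)]
          by (simp add: gram_nth column_set_column form_sym)
      next
        case 3
        then show ?thesis using L[of k] ab by (simp add: orth_on_def gram_nth column_set_column)
      qed
    qed
  qed (simp add: column_set_column)
qed

lemma extend:
  assumes "U \<longlonglongrightarrow> V" "orth_on UNIV V" "local_gp V" "\<And>k. orth_on L (U k)"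
  shows "\<exists>U'. U' \<longlonglongrightarrow> V \<and> (\<forall>k. orth_on UNIV (U' k)) \<and>
    (\<forall>k. \<forall>i\<in>L. column i (U' k) = column i (U k))"
  using assms
proof (induction "card (- L)" arbitrary: L U)
  case 0
  then have "- L = {}" by simp
  then have "L = UNIV" by blast
  then show ?case using 0 by blast
next
  case (Suc n)
  then obtain j where j: "j \<notin> L"
    by (metis Compl_iff card_eq_0_iff ex_in_conv nat.distinct(1))
  obtain U1 where U1: "U1 \<longlonglongrightarrow> V" "\<And>k. orth_on (insert j L) (U1 k)"
    "\<And>k i. i \<noteq> j \<Longrightarrow> column i (U1 k) = column i (U k)"
    using extend_step[OF Suc.prems] by metis
  have "- insert j L = (- L) - {j}" by auto
  then have "n = card (- insert j L)"
    using Suc(2) j by simp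
  from Suc(1)[OF this U1(1) Suc(4,5) U1(2)] obtain U' where U': "U' \<longlonglongrightarrow> V" "\<forall>k. orth_on UNIV (U' k)"
    "\<forall>k. \<forall>i\<in>insert j L. column i (U' k) = column i (U1 k)" by blast
  moreover have "\<forall>k. \<forall>i\<in>L. column i (U' k) = column i (U k)"
    using U'(3) U1(3) j by (metis insertCI)
  ultimately show ?case by blast
qed

lemma nonsing_on_cong:
  assumes "\<And>i. i \<in> L \<Longrightarrow> column i U = column i V"
  shows "nonsing_on L U \<longleftrightarrow> nonsing_on L V"
proof -
  have "(gram U *v x) $ i = (gram V *v x) $ i" if "x \<in> supported_on L" "i \<in> L" for x i
  proof -
    have "gram U $ i $ j * x $ j = gram V $ i $ j * x $ j" for j
      using that assms by (cases "j \<in> L") (auto simp: gram_nth supported_on_iff)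
    then show ?thesis unfolding matrix_vector_mult_def
      by (simp only: vec_lambda_beta)
  qed
  then show ?thesis by (simp add: nonsing_on_def)
qed

end

subsection \<open>Nonsingular principal submatrices\<close>

lemma dim_supported_on_le: "dim (supported_on L) \<le> card L"
proof -
  have "x \<in> span ((\<lambda>i. axis i (1::real)) ` L)" if "x \<in> supported_on L" for x :: "real^'a"
  proof -
    have "(\<Sum>i\<in>UNIV. x $ i *\<^sub>R axis i 1) \<in> span ((\<lambda>i. axis i (1::real)) ` L)"
    proof (rule span_sum)
      fix i
      show "x $ i *\<^sub>R axis i 1 \<in> span ((\<lambda>i. axis i (1::real)) ` L)"
        using that by (cases "i \<in> L") (auto simp: supported_on_iff span_zero intro: span_scale span_base)
    qed
    then show ?thesis
      using basis_expansion[of x] by (simp add: scalar_mult_eq_scaleR)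
  qed
  then have "dim (supported_on L) \<le> card ((\<lambda>i. axis i (1::real)) ` L)"
    by (intro dim_le_card) auto
  also have "\<dots> \<le> card L"
    by (rule card_image_le) simp
  finally show ?thesis .
qed

lemma inner_mult_supported_on:
  fixes V :: "real^'n^'n"
  assumes "x \<in> supported_on L" "\<And>i. i \<in> L \<Longrightarrow> column i V \<bullet> u = 0"
  shows "(V *v x) \<bullet> u = 0"
proof -
  have "(V *v x) \<bullet> u = (\<Sum>i\<in>UNIV. x $ i * (column i V \<bullet> u))"
    by (simp add: matrix_mult_sum inner_sum_left scalar_mult_eq_scaleR)
  also have "\<dots> = 0"
  proof (intro sum.neutral ballI)
    fix i show "x $ i * (column i V \<bullet> u) = 0"
      using assms by (cases "i \<in> L") (auto simp: supported_on_iff)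
  qed
  finally show ?thesis .
qed

text \<open>The values at 0, \<open>\<epsilon>\<close> and \<open>-\<epsilon>\<close> cannot all
  vanish: the first would give \<open>a = 0\<close>, and the sum of the other two would then isolate
  \<open>c\<close>.\<close>

lemma quadratic_nonzero_near_zero:
  fixes a b c :: real
  assumes "c \<noteq> 0" "\<epsilon> > 0"
  obtains t where "\<bar>t\<bar> \<le> \<epsilon>" "a + 2 * t * b + t\<^sup>2 * c \<noteq> 0"
proof -
  have False if *: "\<And>t. \<bar>t\<bar> \<le> \<epsilon> \<Longrightarrow> a + 2 * t * b + t\<^sup>2 * c = 0"
  proof -
    have "a = 0" using *[of 0] assms by simp
    moreover have "a + 2 * \<epsilon> * b + \<epsilon>\<^sup>2 * c = 0" "a + 2 * (-\<epsilon>) * b + (-\<epsilon>)\<^sup>2 * c = 0"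
      using *[of \<epsilon>] *[of "-\<epsilon>"] assms by simp_all
    ultimately have "\<epsilon>\<^sup>2 * c = 0" by simp
    with assms show False by simp
  qed
  then show thesis using that by blast
qed

context stress_form
begin

text \<open>The principal submatrix acts on \<open>supported_on L\<close> as an injective
  endomorphism, hence is onto by dimension.\<close>

lemma nonsing_solve:
  assumes "nonsing_on L V"
  obtains x where "x \<in> supported_on L" "\<And>i. i \<in> L \<Longrightarrow> (gram V *v x) $ i = y $ i"
proof -
  define f where "f x = (\<chi> i. if i \<in> L then (gram V *v x) $ i else 0)" for x
  have lin: "linear f"
    by (rule linearI) (auto simp: f_def vec_eq_iff matrix_vector_right_distrib matrix_vector_mult_scaleR)
  have "inj_on f (supported_on L)"
    unfolding linear_inj_on_iff_eq_0[OF lin subspace_supported_on]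
    using assms unfolding nonsing_on_def f_def vec_eq_iff by auto
  then have "dim (f ` supported_on L) = dim (supported_on L)"
    using dim_image_eq[OF lin, of "supported_on L"] span_eq_iff subspace_supported_on by metis
  moreover have "f ` supported_on L \<subseteq> supported_on L"
    by (auto simp: f_def supported_on_iff)
  ultimately have "f ` supported_on L = supported_on L"
    by (intro subspace_dim_equal linear_subspace_image lin subspace_supported_on) auto
  moreover have "(\<chi> i. if i \<in> L then y $ i else 0) \<in> supported_on L"
    by (simp add: supported_on_iff)
  ultimately have "(\<chi> i. if i \<in> L then y $ i else 0) \<in> f ` supported_on L"
    by (simp only:)
  then obtain x where x: "(\<chi> i. if i \<in> L then y $ i else 0) = f x" "x \<in> supported_on L"
    by (rule imageE)
  show thesis
  proof (rule that[OF x(2)])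
    fix i assume "i \<in> L"
    then show "(gram V *v x) $ i = y $ i"
      using arg_cong[OF x(1), of "\<lambda>u. u $ i"] by (simp add: f_def)
  qed
qed

text \<open>\<open>V *v x\<close> is the projection of \<open>y\<close> to the span of the columns
  in \<open>L\<close>, orthogonal for the form. It exists for an indefinite form because the form is
  nondegenerate on that span.\<close>

lemma orth_complement:
  assumes "nonsing_on L V"
  obtains x where "x \<in> supported_on L" "\<And>i. i \<in> L \<Longrightarrow> column i V \<bullet> (\<Omega> *v (y - V *v x)) = 0"
proof -
  obtain x where "x \<in> supported_on L"
    "\<And>i. i \<in> L \<Longrightarrow> (gram V *v x) $ i = (\<chi> i. column i V \<bullet> (\<Omega> *v y)) $ i"
    using nonsing_solve[OF assms] by metis
  then show thesis
    by (intro that[of x]) (auto simp: gram_mult_nth matrix_vector_mult_diff_distrib inner_diff_right)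
qed

text \<open>If every vector of the complement \<open>W\<close> were isotropic, polarization would
  make \<open>W\<close> totally isotropic. As \<open>W\<close> and the columns in \<open>L\<close>
  together span the space, \<open>W\<close> would lie in the kernel of \<open>\<Omega>\<close>, and
  the rank would be at most \<open>card L\<close>.\<close>

lemma anisotropic_orth_vector:
  assumes ns: "nonsing_on L V" and card: "card L < rank \<Omega>"
  obtains w where "\<And>i. i \<in> L \<Longrightarrow> column i V \<bullet> (\<Omega> *v w) = 0" "w \<bullet> (\<Omega> *v w) \<noteq> 0"
proof -
  have False if contra: "\<And>w. (\<And>i. i \<in> L \<Longrightarrow> column i V \<bullet> (\<Omega> *v w) = 0) \<Longrightarrow> w \<bullet> (\<Omega> *v w) = 0"
  proof -
    define W where "W = {w. \<forall>i\<in>L. column i V \<bullet> (\<Omega> *v w) = 0}"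
    have iso: "w \<bullet> (\<Omega> *v w) = 0" if "w \<in> W" for w
      using contra that unfolding W_def by blast
    have iso2: "w \<bullet> (\<Omega> *v w') = 0" if "w \<in> W" "w' \<in> W" for w w'
    proof -
      have "w + w' \<in> W"
        using that by (auto simp: W_def matrix_vector_right_distrib inner_add_right)
      from iso[OF this] iso[OF that(1)] iso[OF that(2)] show ?thesis
        by (simp add: matrix_vector_right_distrib inner_add_left inner_add_right form_sym[of w' w])
    qed
    have decomp: "\<exists>x\<in>supported_on L. y - V *v x \<in> W" for y
    proof -
      obtain x where "x \<in> supported_on L" "\<And>i. i \<in> L \<Longrightarrow> column i V \<bullet> (\<Omega> *v (y - V *v x)) = 0"
        using orth_complement[OF ns] by metis
      then show ?thesis by (intro bexI[of _ x]) (simp_all add: W_def)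
    qed
    have null: "\<Omega> *v w = 0" if w: "w \<in> W" for w
    proof -
      \<comment> \<open>Pairing with \<open>\<Omega> *v w\<close> itself makes the conclusion say
        that its Euclidean norm is zero.\<close>
      define y where "y = \<Omega> *v w"
      obtain x where x: "x \<in> supported_on L" "y - V *v x \<in> W"
        using decomp by blast
      have "(V *v x) \<bullet> (\<Omega> *v w) = 0"
        using x(1) w by (intro inner_mult_supported_on) (auto simp: W_def)
      then have "y \<bullet> (\<Omega> *v w) = 0"
        using iso2[OF x(2) w] by (simp add: inner_diff_left)
      then show ?thesis by (simp add: y_def)
    qed
    have "range ((*v) \<Omega>) \<subseteq> (\<lambda>x. \<Omega> *v (V *v x)) ` supported_on L"
    proof safe
      fix y
      obtain x where x: "x \<in> supported_on L" "y - V *v x \<in> W"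
        using decomp by blast
      have "\<Omega> *v y = \<Omega> *v (V *v x)"
        using null[OF x(2)] by (simp add: matrix_vector_mult_diff_distrib)
      with x(1) show "\<Omega> *v y \<in> (\<lambda>x. \<Omega> *v (V *v x)) ` supported_on L" by blast
    qed
    then have "rank \<Omega> \<le> dim ((\<lambda>x. (\<Omega> ** V) *v x) ` supported_on L)"
      unfolding rank_dim_range by (intro dim_subset) (simp add: matrix_vector_mul_assoc)
    also have "\<dots> \<le> dim (supported_on L)"
      by (rule dim_image_le) simp
    also have "\<dots> \<le> card L"
      by (rule dim_supported_on_le)
    finally show False using card by simp
  qed
  then show thesis using that by blast
qed

text \<open>The condition \<open>z \<bullet> (\<Omega> *v z) \<noteq> 0\<close> says that the Schur complement of the principal
  submatrix on \<open>L\<close> is nonzero.\<close>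

lemma nonsing_on_insert:
  assumes ns: "nonsing_on L V" and j: "j \<notin> L" and x: "x \<in> supported_on L"
    and z: "\<And>i. i \<in> L \<Longrightarrow> column i V \<bullet> (\<Omega> *v z) = 0" "z \<bullet> (\<Omega> *v z) \<noteq> 0"
    and u: "u = V *v x + z"
  shows "nonsing_on (insert j L) (set_column j u V)"
  unfolding nonsing_on_def
proof (intro ballI impI)
  fix y assume y: "y \<in> supported_on (insert j L)"
    and gr: "\<forall>i\<in>insert j L. (gram (set_column j u V) *v y) $ i = 0"
  define \<eta> where "\<eta> = y $ j"
  define y0 where "y0 = y - \<eta> *\<^sub>R axis j 1"
  have y0: "y0 \<in> supported_on L" "y0 $ j = 0"
    using y by (auto simp: y0_def \<eta>_def supported_on_iff axis_def)
  have "set_column j u V *v y = (\<Sum>i\<in>UNIV. y $ i *\<^sub>R (if i = j then u else column i V))"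
    by (simp add: matrix_mult_sum column_set_column scalar_mult_eq_scaleR)
  also have "\<dots> = (\<Sum>i\<in>UNIV. y0 $ i *\<^sub>R column i V + (if i = j then \<eta> *\<^sub>R u else 0))"
    by (rule sum.cong) (auto simp: y0_def \<eta>_def axis_def)
  also have "\<dots> = V *v y0 + \<eta> *\<^sub>R u"
    by (simp add: sum.distrib matrix_mult_sum scalar_mult_eq_scaleR)
  also have "\<dots> = V *v (y0 + \<eta> *\<^sub>R x) + \<eta> *\<^sub>R z"
    by (simp add: u matrix_vector_right_distrib matrix_vector_mult_scaleR scaleR_add_right)
  finally have Uy: "set_column j u V *v y = V *v (y0 + \<eta> *\<^sub>R x) + \<eta> *\<^sub>R z" .
  have supp: "y0 + \<eta> *\<^sub>R x \<in> supported_on L"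
    using y0(1) x by (simp add: supported_on_iff)
  \<comment> \<open>The rows in \<open>L\<close> do not see \<open>z\<close>, so nonsingularity on
    \<open>L\<close> kills the combination of old columns. Row \<open>j\<close> then reads
    \<open>\<eta>\<close> times the Schur complement.\<close>
  have "(gram V *v (y0 + \<eta> *\<^sub>R x)) $ i = 0" if "i \<in> L" for i
  proof -
    have "(gram (set_column j u V) *v y) $ i = 0" using gr that by blast
    moreover have "i \<noteq> j" using that j by blast
    ultimately show ?thesis
      using z(1)[OF that]
      unfolding gram_mult_nth Uy column_set_column
      by (simp add: matrix_vector_right_distrib matrix_vector_mult_scaleR inner_add_right)
  qed
  then have 0: "y0 + \<eta> *\<^sub>R x = 0"
    using ns supp unfolding nonsing_on_def by blast
  have "(gram (set_column j u V) *v y) $ j = 0" using gr by blast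
  then have "\<eta> * (u \<bullet> (\<Omega> *v z)) = 0"
    unfolding gram_mult_nth Uy column_set_column 0 by (simp add: matrix_vector_mult_scaleR)
  moreover have "u \<bullet> (\<Omega> *v z) = z \<bullet> (\<Omega> *v z)"
    using inner_mult_supported_on[OF x z(1)] by (simp add: u inner_add_left)
  ultimately have "\<eta> = 0" using z(2) by simp
  with 0 show "y = 0" by (simp add: y0_def)
qed

section \<open>Density of representations with nonzero principal minors\<close>

definition reps :: "(real^'n^'n) set" where
  "reps = {V. orth_on UNIV V \<and> local_gp V}"

text \<open>Moving column \<open>j\<close> along an anisotropic \<open>w\<close> orthogonal to the
  columns in \<open>L\<close> keeps the relations with \<open>L\<close> and makes the minor on
  \<open>insert j L\<close> nonzero for suitable \<open>t k\<close> tending to 0.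
  \<open>extend\<close> then repairs the other vertices without touching these columns.\<close>

lemma nonsing_insert_dense:
  assumes V: "V \<in> reps" and ns: "nonsing_on L V" and j: "j \<notin> L" and card: "card L < rank \<Omega>"
  shows "V \<in> closure (reps \<inter> {V. nonsing_on (insert j L) V})"
proof -
  have orth: "orth_on UNIV V" and lgp: "local_gp V"
    using V by (auto simp: reps_def)
  obtain x where x: "x \<in> supported_on L"
    "\<And>i. i \<in> L \<Longrightarrow> column i V \<bullet> (\<Omega> *v (column j V - V *v x)) = 0"
    using orth_complement[OF ns] by metis
  obtain w where w: "\<And>i. i \<in> L \<Longrightarrow> column i V \<bullet> (\<Omega> *v w) = 0" "w \<bullet> (\<Omega> *v w) \<noteq> 0"
    using anisotropic_orth_vector[OF ns card] by metis
  \<comment> \<open>The part of the moved column orthogonal to the columns in \<open>L\<close>. Its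
    value under the form is the Schur complement, a quadratic in \<open>t\<close> with nonzero
    leading coefficient.\<close>
  define z where "z t = column j V - V *v x + t *\<^sub>R w" for t
  have z: "z t \<bullet> (\<Omega> *v z t) = z 0 \<bullet> (\<Omega> *v z 0) + 2 * t * (z 0 \<bullet> (\<Omega> *v w)) + t\<^sup>2 * (w \<bullet> (\<Omega> *v w))" for t
  proof -
    have "z t = z 0 + t *\<^sub>R w" by (simp add: z_def)
    then show ?thesis
      by (simp add: matrix_vector_right_distrib matrix_vector_mult_scaleR inner_add_left inner_add_right
          form_sym[of w "z 0"] power2_eq_square algebra_simps)
  qed
  have "\<exists>t. \<bar>t\<bar> \<le> inverse (real (Suc k)) \<and> z t \<bullet> (\<Omega> *v z t) \<noteq> 0" for k
  proof -
    have "inverse (real (Suc k)) > 0" by simp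
    from quadratic_nonzero_near_zero[OF w(2) this]
    obtain t where "\<bar>t\<bar> \<le> inverse (real (Suc k))"
      "z 0 \<bullet> (\<Omega> *v z 0) + 2 * t * (z 0 \<bullet> (\<Omega> *v w)) + t\<^sup>2 * (w \<bullet> (\<Omega> *v w)) \<noteq> 0" .
    then show ?thesis using z[of t] by auto
  qed
  then obtain t where t: "\<And>k. \<bar>t k\<bar> \<le> inverse (real (Suc k))" "\<And>k. z (t k) \<bullet> (\<Omega> *v z (t k)) \<noteq> 0"
    by metis
  have t0: "t \<longlonglongrightarrow> 0"
    by (rule tendsto_0_le[OF LIMSEQ_inverse_real_of_nat, where K = 1]) (use t(1) in auto)
  define U where "U k = set_column j (column j V + t k *\<^sub>R w) V" for k
  have limU: "U \<longlonglongrightarrow> V"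
  proof -
    have "(\<lambda>k. column j V + t k *\<^sub>R w) \<longlonglongrightarrow> column j V + 0 *\<^sub>R w"
      by (intro tendsto_intros t0)
    from tendsto_set_column[OF this tendsto_const, of j V] show ?thesis
      by (simp add: U_def[abs_def])
  qed
  have orthU: "orth_on (insert j L) (U k)" for k
  proof -
    have V0: "column a V \<bullet> (\<Omega> *v column b V) = 0" if "N a b" for a b
      using orth that by (auto simp: orth_on_def gram_nth)
    have Uj: "gram (U k) $ l $ j = 0" if "l \<in> L" "N l j" for l
    proof -
      have "l \<noteq> j" using that j by blast
      then show ?thesis
        using V0[OF that(2)] w(1)[OF that(1)]
        by (simp add: gram_nth U_def column_set_column matrix_vector_right_distrib
            matrix_vector_mult_scaleR inner_add_right)
    qed
    show ?thesis
      unfolding orth_on_def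
    proof (intro ballI impI)
      fix a b assume ab: "a \<in> insert j L" "b \<in> insert j L" "N a b"
      consider "b = j" "a \<in> L" | "a = j" "b \<in> L" | "a \<in> L" "b \<in> L"
        using ab N_irrefl by blast
      then show "gram (U k) $ a $ b = 0"
      proof cases
        case 1
        then show ?thesis using Uj ab(3) by simp
      next
        case 2
        then show ?thesis using Uj[of b] N_sym[OF ab(3)] by (simp add: gram_sym[of _ j])
      next
        case 3
        then have "a \<noteq> j" "b \<noteq> j" using j by auto
        then show ?thesis using V0[OF ab(3)] by (simp add: gram_nth U_def column_set_column)
      qed
    qed
  qed
  have nsU: "nonsing_on (insert j L) (U k)" for k
    unfolding U_def
  proof (rule nonsing_on_insert[OF ns j x(1)])
    show "column i V \<bullet> (\<Omega> *v z (t k)) = 0" if "i \<in> L" for i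
      using x(2)[OF that] w(1)[OF that]
      by (simp add: z_def matrix_vector_right_distrib matrix_vector_mult_scaleR inner_add_right)
  qed (use t in \<open>auto simp: z_def\<close>)
  obtain U' where U': "U' \<longlonglongrightarrow> V" "\<And>k. orth_on UNIV (U' k)"
    "\<And>k i. i \<in> insert j L \<Longrightarrow> column i (U' k) = column i (U k)"
    using extend[OF limU orth lgp orthU] by blast
  have "nonsing_on (insert j L) (U' k)" for k
    using nsU nonsing_on_cong[OF U'(3)] by blast
  \<comment> \<open>The extension yields orthogonality only; local general position is recovered
    afterwards, being an open condition that holds at \<open>V\<close>.\<close>
  then have "V \<in> closure ({V. orth_on UNIV V} \<inter> {V. nonsing_on (insert j L) V})"
    unfolding closure_sequential using U'(1,2) by blast
  with lgp open_Int_closure_subset[OF open_local_gp]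
  have "V \<in> closure ({V. local_gp V} \<inter> ({V. orth_on UNIV V} \<inter> {V. nonsing_on (insert j L) V}))"
    by blast
  then show ?thesis
    by (rule subsetD[OF closure_mono, rotated]) (auto simp: reps_def)
qed

lemma nonsing_dense:
  assumes "card L \<le> rank \<Omega>"
  shows "reps \<subseteq> closure (reps \<inter> {V. nonsing_on L V})"
proof -
  have "finite L" by simp
  then show ?thesis using assms
  proof (induction L)
    case empty
    have "nonsing_on {} V" for V
      by (simp add: nonsing_on_def supported_on_iff vec_eq_iff)
    then show ?case by (simp add: closure_subset)
  next
    case (insert j L)
    have "reps \<inter> {V. nonsing_on L V} \<subseteq> closure (reps \<inter> {V. nonsing_on (insert j L) V})"
      using nonsing_insert_dense insert by auto
    then have "closure (reps \<inter> {V. nonsing_on L V}) \<subseteq> closure (reps \<inter> {V. nonsing_on (insert j L) V})"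
      by (rule closure_minimal) simp
    with insert show ?case by auto
  qed
qed

text \<open>Each nonsingularity condition is open and dense within \<open>reps\<close>, so finitely
  many of them can be imposed in succession.\<close>

lemma all_nonsing_dense:
  assumes "finite F" "\<And>L. L \<in> F \<Longrightarrow> card L \<le> rank \<Omega>"
  shows "reps \<subseteq> closure (reps \<inter> {V. \<forall>L\<in>F. nonsing_on L V})"
  using assms
proof (induction F)
  case empty
  then show ?case by (simp add: closure_subset)
next
  case (insert L F)
  let ?O = "{V. \<forall>L\<in>F. nonsing_on L V}"
  have "?O = (\<Inter>L\<in>F. {V. nonsing_on L V})" by auto
  then have "open ?O"
    using insert.hyps open_nonsing_on by (auto intro!: open_INT)
  from open_Int_closure_subset[OF this]
  have "?O \<inter> reps \<subseteq> closure (?O \<inter> (reps \<inter> {V. nonsing_on L V}))"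
    using nonsing_dense[of L] insert.prems by blast
  also have "?O \<inter> (reps \<inter> {V. nonsing_on L V}) = reps \<inter> {V. \<forall>L\<in>insert L F. nonsing_on L V}"
    by auto
  finally have "closure (?O \<inter> reps) \<subseteq> closure (reps \<inter> {V. \<forall>L\<in>insert L F. nonsing_on L V})"
    by (rule closure_minimal) simp
  with insert show ?case by (auto simp: Int_commute)
qed

end

subsection \<open>Frameworks and their stresses\<close>

lemma aff_dim_full_iff:
  fixes S :: "'a::euclidean_space set"
  shows "aff_dim S = int DIM('a) \<longleftrightarrow> (\<forall>a b. a \<noteq> 0 \<longrightarrow> \<not> S \<subseteq> {x. a \<bullet> x = b})"
proof
  assume full: "aff_dim S = int DIM('a)"
  show "\<forall>a b. a \<noteq> 0 \<longrightarrow> \<not> S \<subseteq> {x. a \<bullet> x = b}"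
  proof (intro allI impI notI)
    fix a :: 'a and b assume "a \<noteq> 0" "S \<subseteq> {x. a \<bullet> x = b}"
    then show False
      using aff_dim_subset[of S "{x. a \<bullet> x = b}"] full by simp
  qed
next
  assume "\<forall>a b. a \<noteq> 0 \<longrightarrow> \<not> S \<subseteq> {x. a \<bullet> x = b}"
  then have "\<not> aff_dim S < int DIM('a)"
    using aff_lowdim_subset_hyperplane[of S] by metis
  then show "aff_dim S = int DIM('a)"
    using aff_dim_le_DIM[of S] by simp
qed

lemma aff_dim_Un_image_le:
  fixes f :: "'b \<Rightarrow> 'a::euclidean_space"
  assumes "finite D"
  shows "aff_dim (A \<union> f ` D) \<le> aff_dim A + int (card D)"
  using assms by (induction D) (auto simp: aff_dim_insert)

text \<open>A small set of vertices on too small a flat can be enlarged to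
  \<open>CARD('d) + 1\<close> vertices. Each new point raises the dimension by at most one, so the
  enlarged set still lies on a hyperplane.\<close>

lemma affine_general_position_iff:
  fixes p :: "real^'d^'n"
  assumes "CARD('n) \<ge> CARD('d) + 1"
  shows "affine_general_position p \<longleftrightarrow>
    (\<forall>K a b. card K = CARD('d) + 1 \<longrightarrow> a \<noteq> 0 \<longrightarrow> (\<exists>i\<in>K. a \<bullet> p $ i \<noteq> b))"
proof
  assume gp: "affine_general_position p"
  show "\<forall>K a b. card K = CARD('d) + 1 \<longrightarrow> a \<noteq> 0 \<longrightarrow> (\<exists>i\<in>K. a \<bullet> p $ i \<noteq> b)"
  proof (intro allI impI)
    fix K :: "'n set" and a :: "real^'d" and b
    assume K: "card K = CARD('d) + 1" and a: "a \<noteq> 0"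
    have "aff_dim {x. a \<bullet> x = b} = int (card K) - 2"
      using a K by simp
    then show "\<exists>i\<in>K. a \<bullet> p $ i \<noteq> b"
      using gp[unfolded affine_general_position_def, rule_format, of K] K affine_hyperplane[of a b]
      by auto
  qed
next
  assume hyp: "\<forall>K a b. card K = CARD('d) + 1 \<longrightarrow> a \<noteq> 0 \<longrightarrow> (\<exists>i\<in>K. a \<bullet> p $ i \<noteq> b)"
  show "affine_general_position p"
    unfolding affine_general_position_def
  proof (intro allI impI notI, elim exE conjE)
    fix K :: "'n set" and A :: "(real^'d) set"
    assume K: "card K \<le> CARD('d) + 1" and A: "aff_dim A = int (card K) - 2" "\<forall>i\<in>K. p $ i \<in> A"
    obtain K' where K': "K \<subseteq> K'" "card K' = CARD('d) + 1"
      using exists_subset_between[of K "CARD('d) + 1" UNIV] K assms by auto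
    have "aff_dim (A \<union> ($) p ` (K' - K)) \<le> aff_dim A + int (card (K' - K))"
      by (rule aff_dim_Un_image_le) simp
    also have "card (K' - K) = CARD('d) + 1 - card K"
      using K' by (simp add: card_Diff_subset)
    finally have "aff_dim (A \<union> ($) p ` (K' - K)) < int (DIM(real^'d))"
      using A(1) K by simp
    then obtain a b where a: "a \<noteq> 0" and sub: "A \<union> ($) p ` (K' - K) \<subseteq> {x. a \<bullet> x = b}"
      by (rule aff_lowdim_subset_hyperplane)
    have mem: "p $ i \<in> A \<union> ($) p ` (K' - K)" if "i \<in> K'" for i
      using A(2) that by blast
    obtain i where "i \<in> K'" "a \<bullet> p $ i \<noteq> b"
      using hyp K'(2) a by metis
    with subsetD[OF sub mem] show False by simp
  qed
qed

text \<open>These vectors form the span of the coordinate vectors of \<open>p\<close> and the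
  all-ones vector. A stress annihilates all of them.\<close>

definition aff_values :: "real^'d^'n \<Rightarrow> real^'d \<Rightarrow> real \<Rightarrow> real^'n" where
  "aff_values p a b = (\<chi> i. a \<bullet> p $ i + b)"

lemma aff_values_nth [simp]: "aff_values p a b $ i = a \<bullet> p $ i + b"
  by (simp add: aff_values_def)

lemma aff_values_expand:
  "aff_values p a b = (\<Sum>k\<in>UNIV. a $ k *\<^sub>R (\<chi> i. p $ i $ k)) + b *\<^sub>R (\<chi> i. 1)"
  by (simp add: vec_eq_iff inner_vec_def)

lemma mult_aff_values:
  fixes T :: "real^'n^'m"
  assumes "T *v (\<chi> i. 1) = (\<chi> i. 1)" "\<And>k. T *v (\<chi> i. q $ i $ k) = (\<chi> i. p $ i $ k)"
  shows "T *v aff_values q a b = aff_values p a b"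
  unfolding aff_values_expand
  by (simp add: matrix_vector_right_distrib matrix_vector_mult_scaleR assms
      linear_sum[OF matrix_vector_mul_linear])

lemma equilibrium_iff_coordinates:
  "(\<forall>i. (\<Sum>j\<in>UNIV. (\<Omega> $ i $ j) *\<^sub>R (p $ j)) = 0) \<longleftrightarrow> (\<forall>k. \<Omega> *v (\<chi> i. p $ i $ k) = 0)"
  by (auto simp: vec_eq_iff matrix_vector_mult_def)

lemma stress_aff_values:
  assumes "equilibrium_stress_matrix E p \<Omega>"
  shows "\<Omega> *v aff_values p a b = 0"
proof -
  have "\<Omega> *v (\<chi> i. 1) = 0" "\<And>k. \<Omega> *v (\<chi> i. p $ i $ k) = 0"
    using assms unfolding equilibrium_stress_matrix_def equilibrium_iff_coordinates by blast+
  then show ?thesis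
    unfolding aff_values_expand
    by (simp add: matrix_vector_right_distrib matrix_vector_mult_scaleR
        linear_sum[OF matrix_vector_mul_linear])
qed

text \<open>The kernel of a symmetric matrix is the orthogonal complement of its range.\<close>

lemma dim_kernel_symmetric:
  fixes \<Omega> :: "real^'n^'n"
  assumes "transpose \<Omega> = \<Omega>"
  shows "dim {x. \<Omega> *v x = 0} + rank \<Omega> = CARD('n)"
proof -
  have sym: "x \<bullet> (\<Omega> *v y) = y \<bullet> (\<Omega> *v x)" for x y
    by (metis assms dot_lmul_matrix inner_commute transpose_matrix_vector)
  have "{x. \<Omega> *v x = 0} = {y \<in> UNIV. \<forall>x\<in>range ((*v) \<Omega>). orthogonal x y}"
  proof -
    have "\<Omega> *v y = 0 \<longleftrightarrow> (\<forall>x. (\<Omega> *v x) \<bullet> y = 0)" for y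
      by (metis inner_commute inner_eq_zero_iff inner_zero_right sym)
    then show ?thesis by (auto simp: orthogonal_def)
  qed
  moreover have "subspace (range ((*v) \<Omega>))"
    by (simp add: linear_subspace_image)
  ultimately show ?thesis
    using dim_subspace_orthogonal_to_vectors[of "range ((*v) \<Omega>)" UNIV]
    by (simp add: rank_dim_range)
qed

text \<open>When \<open>p\<close> spans affinely, \<open>(a, b)\<close> is determined by its values
  on \<open>p\<close>, so the affine functions fill a space of dimension \<open>CARD('d) + 1\<close>
  inside the kernel. Maximal rank gives the kernel the same dimension.\<close>

lemma stress_kernel:
  fixes p :: "real^'d^'n"
  assumes \<Omega>: "equilibrium_stress_matrix E p \<Omega>" and rank: "rank \<Omega> + CARD('d) + 1 = CARD('n)"
    and span: "\<And>a b. (\<forall>i. a \<bullet> p $ i = b) \<Longrightarrow> a = 0"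
    and x: "\<Omega> *v x = 0"
  obtains a b where "x = aff_values p a b"
proof -
  define f where "f = (\<lambda>(a, b). aff_values p a b)"
  have lin: "linear f"
    by (rule linearI) (auto simp: f_def vec_eq_iff inner_add_left algebra_simps)
  have "c = 0" if "f c = 0" for c
  proof -
    obtain a b where c: "c = (a, b)" by (cases c)
    have *: "a \<bullet> p $ i = - b" for i
      using that by (simp add: c f_def vec_eq_iff eq_neg_iff_add_eq_0)
    then have "a = 0" using span by blast
    then show ?thesis using * c by (simp add: zero_prod_def)
  qed
  then have "inj f"
    using linear_injective_0[OF lin] by blast
  then have "dim (range f) = DIM((real^'d) \<times> real)"
    using dim_image_eq[OF lin, of UNIV] by (simp add: inj_on_def)
  then have "dim {x. \<Omega> *v x = 0} \<le> dim (range f)"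
    using dim_kernel_symmetric[of \<Omega>] \<Omega> rank by (simp add: equilibrium_stress_matrix_def)
  moreover have "range f \<subseteq> {x. \<Omega> *v x = 0}"
    using stress_aff_values[OF \<Omega>] by (auto simp: f_def)
  moreover have "subspace {x. \<Omega> *v x = 0}"
    by (rule linear_subspace_kernel) simp
  moreover have "subspace (range f)"
    by (simp add: lin linear_subspace_image)
  ultimately have "range f = {x. \<Omega> *v x = 0}"
    using subspace_dim_equal by blast
  with x obtain c where "x = f c" by blast
  then show thesis using that by (cases c) (simp add: f_def)
qed

section \<open>General position forces full local spans\<close>

lemma Gstressable_imp_Fstressable:
  fixes p :: "real^'d^'n"
  assumes n: "CARD('n) \<ge> CARD('d) + 2" and G: "Gstressable E p"
  shows "Fstressable E p"
proof -
  have gp: "\<exists>i\<in>K. a \<bullet> p $ i \<noteq> b" if "card K = CARD('d) + 1" "a \<noteq> 0" for K a b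
    using G n that by (simp add: Gstressable_def affine_general_position_iff)
  obtain \<Omega> where \<Omega>: "equilibrium_stress_matrix E p \<Omega>" and rank: "rank \<Omega> + CARD('d) + 1 = CARD('n)"
    using G by (auto simp: Gstressable_def has_max_rank_stress_def)
  have large: "\<exists>i\<in>K. a \<bullet> p $ i \<noteq> b" if K: "card K \<ge> CARD('d) + 1" and a: "a \<noteq> 0" for K a b
  proof -
    obtain K' where K': "K' \<subseteq> K" "card K' = CARD('d) + 1"
      using ex_card[OF K] by blast
    from gp[OF K'(2) a, of b] K'(1) show ?thesis by blast
  qed
  have span: "a = 0" if "\<forall>i. a \<bullet> p $ i = b" for a b
    using large[of UNIV a b] n that by auto
  have "False" if "a \<noteq> 0" and sub: "insert (p $ i) {p $ j |j. {i, j} \<in> E} \<subseteq> {x. a \<bullet> x = b}" for i a b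
  proof -
    define K where "K = insert i {j. {i, j} \<in> E}"
    have "\<forall>l\<in>K. a \<bullet> p $ l = b" using sub by (auto simp: K_def)
    then have "card K < CARD('d) + 1"
      using large[of K a b] that(1) by force
    \<comment> \<open>With exactly \<open>CARD('d) + 1\<close> vertices, general position makes the
      points affinely independent, while row \<open>i\<close> of the stress is still supported on
      them.\<close>
    then obtain K' where K': "K \<subseteq> K'" "card K' = CARD('d) + 1"
      using exists_subset_between[of K "CARD('d) + 1" UNIV] n by auto
    have supp: "\<Omega> $ i $ j = 0" if "j \<notin> K'" for j
    proof -
      have "i \<noteq> j" "{i, j} \<notin> E" using that K'(1) by (auto simp: K_def)
      then show ?thesis using \<Omega> unfolding equilibrium_stress_matrix_def by blast
    qed
    have row: "\<Omega> $ i $ j = 0" for j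
    proof (cases "j \<in> K'")
      case True
      have "aff_dim (($) p ` (K' - {j})) < int DIM(real^'d)"
      proof -
        have "card (($) p ` (K' - {j})) \<le> CARD('d)"
          using card_image_le[of "K' - {j}" "($) p"] K'(2) True by simp
        then show ?thesis
          using aff_dim_le_card[of "($) p ` (K' - {j})"] by simp
      qed
      \<comment> \<open>A hyperplane through the other points of \<open>K'\<close> misses
        \<open>p $ j\<close>. Applying row \<open>i\<close> to the affine function vanishing on it
        isolates the single entry at \<open>j\<close>.\<close>
      then obtain c e where ce: "c \<noteq> 0" "($) p ` (K' - {j}) \<subseteq> {x. c \<bullet> x = e}"
        by (rule aff_lowdim_subset_hyperplane)
      have j: "c \<bullet> p $ j \<noteq> e"
        using gp[OF K'(2) ce(1), of e] ce(2) by blast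
      have "0 = (\<Omega> *v aff_values p c (- e)) $ i"
        by (simp add: stress_aff_values[OF \<Omega>])
      also have "\<dots> = (\<Sum>l\<in>UNIV. \<Omega> $ i $ l * (c \<bullet> p $ l - e))"
        by (simp add: matrix_vector_mult_def)
      also have "\<dots> = (\<Sum>l\<in>{j}. \<Omega> $ i $ l * (c \<bullet> p $ l - e))"
        by (rule sum.mono_neutral_right) (use ce(2) supp in force)+
      finally show ?thesis using j by simp
    qed (rule supp)
    have "\<Omega> *v axis i 1 = 0"
    proof -
      have "\<Omega> $ j $ i = 0" for j
        using \<Omega> row[of j] unfolding equilibrium_stress_matrix_def
        by (metis (no_types) transpose_def vec_lambda_beta)
      then show ?thesis by (simp add: matrix_vector_mult_basis column_def vec_eq_iff)
    qed
    from stress_kernel[OF \<Omega> rank span this]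
    \<comment> \<open>This affine function vanishes at the other vertices, of which there are at
      least \<open>CARD('d) + 1\<close>. Hence its linear part is zero and it is constant, yet it
      takes both values 0 and 1.\<close>
    obtain c e where ce: "axis i 1 = aff_values p c e" .
    have val: "c \<bullet> p $ l + e = (if l = i then 1 else 0)" for l
      using arg_cong[OF ce, of "\<lambda>x. x $ l"] by (simp add: axis_def)
    have "card (UNIV - {i}) \<ge> CARD('d) + 1"
      using n by (simp add: card_Diff_singleton)
    moreover have "\<forall>l\<in>UNIV - {i}. c \<bullet> p $ l = - e"
      using val by (simp add: eq_neg_iff_add_eq_0)
    ultimately have c: "c = 0" using large by blast
    from \<open>card (UNIV - {i}) \<ge> CARD('d) + 1\<close> have "UNIV - {i} \<noteq> {}"
      by (metis add_is_0 card.empty le_0_eq one_neq_zero)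
    then obtain l where "l \<noteq> i" by blast
    then show False using val[of l] val[of i] c by simp
  qed
  then have "aff_dim (insert (p $ i) {p $ j |j. {i, j} \<in> E}) = int DIM(real^'d)" for i
    unfolding aff_dim_full_iff by blast
  then show ?thesis
    using G by (simp add: Fstressable_def Gstressable_def)
qed

section \<open>From a representation back to a framework\<close>

context stress_form
begin

lemma rank_gram:
  assumes "invertible T"
  shows "rank (gram T) = rank \<Omega>"
proof (rule antisym)
  show "rank (gram T) \<le> rank \<Omega>"
    unfolding gram_def using rank_mul_le_left rank_mul_le_right order_trans by metis
  obtain T' where T': "T ** T' = mat 1"
    using assms by (auto simp: invertible_def)
  have "\<Omega> = transpose (T ** T') ** \<Omega> ** (T ** T')"
    by (simp add: T')
  also have "\<dots> = transpose T' ** gram T ** T'"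
    by (simp add: gram_def matrix_transpose_mul matrix_mul_assoc)
  finally show "rank \<Omega> \<le> rank (gram T)"
    using rank_mul_le_left rank_mul_le_right order_trans by metis
qed

lemma transpose_gram: "transpose (gram T) = gram T"
  by (simp add: gram_def matrix_transpose_mul matrix_mul_assoc transpose_\<Omega>)

text \<open>Rescaling the columns of \<open>V\<close> by \<open>s = V\<^sup>-\<^sup>1 1\<close> restores the all-ones vector to the kernel.\<close>

lemma Gstressable_gram:
  fixes p q :: "real^'d^'n"
  assumes N: "\<And>i j. N i j \<longleftrightarrow> i \<noteq> j \<and> {i, j} \<notin> E"
    and \<Omega>: "equilibrium_stress_matrix E p \<Omega>" and rank: "rank \<Omega> + CARD('d) + 1 = CARD('n)"
    and span: "\<And>a b. (\<forall>i. a \<bullet> p $ i = b) \<Longrightarrow> a = 0"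
    and inv: "invertible V" and orth: "orth_on UNIV V"
    and ns: "\<And>L. card L = rank \<Omega> \<Longrightarrow> nonsing_on L V"
    and s: "V *v s = (\<chi> i. 1)" "\<And>i. s $ i \<noteq> 0"
    and q: "\<And>k. V *v (\<chi> i. s $ i * q $ i $ k) = (\<chi> i. p $ i $ k)"
  shows "Gstressable E q"
proof -
  \<comment> \<open>\<open>V\<close> times the diagonal matrix of \<open>s\<close>. The scaling
    multiplies Gram entries by \<open>s $ i * s $ j\<close>, which preserves the zero
    pattern.\<close>
  define T where "T = (\<chi> i j. V $ i $ j * s $ j)"
  have T: "T *v x = V *v (\<chi> i. s $ i * x $ i)" for x
    by (simp add: T_def matrix_vector_mult_def vec_eq_iff mult_ac)
  have Tinj: "x = 0" if "T *v x = 0" for x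
  proof -
    have "(\<chi> i. s $ i * x $ i) = 0"
      using that inv unfolding T invertible_left_inverse matrix_left_invertible_ker by blast
    then show ?thesis using s(2) by (simp add: vec_eq_iff)
  qed
  then have Tinv: "invertible T"
    by (simp add: invertible_left_inverse matrix_left_invertible_ker)
  have T1: "T *v (\<chi> i. 1) = (\<chi> i. 1)"
    using s(1) by (simp add: T vec_lambda_eta)
  have Tq: "T *v (\<chi> i. q $ i $ k) = (\<chi> i. p $ i $ k)" for k
    using q by (simp add: T)
  have gT: "gram T *v x = transpose T *v (\<Omega> *v (T *v x))" for x
    by (simp only: gram_def matrix_vector_mul_assoc matrix_mul_assoc)
  have "gram T $ i $ j = s $ i * s $ j * gram V $ i $ j" for i j
  proof -
    have "column i T = s $ i *\<^sub>R column i V" for i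
      by (simp add: T_def column_def vec_eq_iff)
    then show ?thesis by (simp add: gram_nth matrix_vector_mult_scaleR)
  qed
  moreover have "gram V $ i $ j = 0" if "i \<noteq> j" "{i, j} \<notin> E" for i j
    using orth that N by (simp add: orth_on_def)
  moreover have "\<Omega> *v (\<chi> i. 1) = 0" "\<And>k. \<Omega> *v (\<chi> i. p $ i $ k) = 0"
    using \<Omega> unfolding equilibrium_stress_matrix_def equilibrium_iff_coordinates by blast+
  ultimately have "equilibrium_stress_matrix E q (gram T)"
    unfolding equilibrium_stress_matrix_def equilibrium_iff_coordinates
    by (simp only: transpose_gram gT T1 Tq) simp
  moreover have "affine_general_position q"
  proof -
    have "\<exists>i\<in>K. a \<bullet> q $ i \<noteq> b" if K: "card K = CARD('d) + 1" and a: "a \<noteq> 0" for K a b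
    proof (rule ccontr)
      assume "\<not> ?thesis"
      then have b: "\<And>i. i \<in> K \<Longrightarrow> a \<bullet> q $ i = b" by blast
      \<comment> \<open>\<open>T\<close> sends \<open>y\<close> to an affine function of
        \<open>p\<close>, hence into the kernel of \<open>\<Omega>\<close>. The rescaled vector
        \<open>c\<close> is therefore killed by \<open>gram V\<close> and vanishes on
        \<open>K\<close>, whose complement has exactly \<open>rank \<Omega>\<close>
        elements.\<close>
      define y where "y = aff_values q a (- b)"
      define c where "c = (\<chi> i. s $ i * y $ i)"
      have Ty: "T *v y = aff_values p a (- b)"
        unfolding y_def by (rule mult_aff_values[OF T1 Tq])
      have "gram V *v c = transpose V *v (\<Omega> *v (T *v y))"
        by (simp only: T c_def gram_def matrix_vector_mul_assoc matrix_mul_assoc)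
      also have "\<dots> = 0"
        unfolding Ty stress_aff_values[OF \<Omega>] by simp
      finally have "gram V *v c = 0" .
      moreover have "c \<in> supported_on (- K)"
        using b by (simp add: c_def y_def supported_on_iff)
      moreover have "card (- K) = rank \<Omega>"
        using card_Diff_subset[of K UNIV] K rank by (simp flip: Compl_eq_Diff_UNIV)
      ultimately have "c = 0"
        using ns[of "- K"] unfolding nonsing_on_def by (metis zero_index)
      then have "aff_values p a (- b) = 0"
        using T[of y] Ty by (simp flip: c_def)
      then have "\<forall>i. a \<bullet> p $ i = b" by (simp add: vec_eq_iff)
      then show False using span a by blast
    qed
    then show ?thesis
      using affine_general_position_iff[of q] rank by simp
  qed
  moreover have "rank (gram T) + CARD('d) + 1 = CARD('n)"
    using rank by (simp add: rank_gram[OF Tinv])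
  ultimately show ?thesis
    unfolding Gstressable_def has_max_rank_stress_def by blast
qed

end

section \<open>Approximation by Gstressable frameworks\<close>

lemma Fstressable_imp_closure:
  fixes p :: "real^'d^'n"
  assumes "Fstressable E p"
  shows "p \<in> closure {q :: real^'d^'n. Gstressable E q}"
proof -
  obtain \<Omega> where \<Omega>: "equilibrium_stress_matrix E p \<Omega>" and rank: "rank \<Omega> + CARD('d) + 1 = CARD('n)"
    using assms by (auto simp: Fstressable_def has_max_rank_stress_def)
  have "aff_dim (insert (p $ i) {p $ j |j. {i, j} \<in> E}) = int DIM(real^'d)" for i
    using assms by (simp add: Fstressable_def)
  then have local_span: "a = 0" if "a \<bullet> p $ i = b" "\<And>j. {i, j} \<in> E \<Longrightarrow> a \<bullet> p $ j = b" for a b i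
    using that unfolding aff_dim_full_iff by blast
  then have span: "a = 0" if "\<forall>i. a \<bullet> p $ i = b" for a b
    using that by blast
  define N where "N i j \<longleftrightarrow> i \<noteq> j \<and> {i, j} \<notin> E" for i j
  interpret stress_form \<Omega> N
  proof
    show "transpose \<Omega> = \<Omega>" using \<Omega> by (simp add: equilibrium_stress_matrix_def)
  qed (auto simp: N_def insert_commute)
  \<comment> \<open>At the identity the Gram matrix is \<open>\<Omega>\<close> itself. A kernel
    vector supported on the non-neighbours of \<open>i\<close> is an affine function vanishing at
    \<open>i\<close> and its neighbours, so the full local span makes it zero.\<close>
  have "mat 1 \<in> reps"
  proof -
    have "gram (mat 1) = \<Omega>" by (simp add: gram_def)
    moreover have "x = 0" if x: "x \<in> supported_on {j. N i j}" "(\<Omega> ** mat 1) *v x = 0" for x i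
    proof -
      have "\<Omega> *v x = 0" using x(2) by simp
      from stress_kernel[OF \<Omega> rank span this]
      obtain a b where ab: "x = aff_values p a b" .
      have "a \<bullet> p $ j = - b" if "\<not> N i j" for j
        using x(1) that by (simp add: ab supported_on_iff eq_neg_iff_add_eq_0)
      then have *: "a \<bullet> p $ i = - b" "\<And>j. {i, j} \<in> E \<Longrightarrow> a \<bullet> p $ j = - b"
        by (auto simp: N_def)
      with local_span have "a = 0" by blast
      with * ab show ?thesis by (simp add: vec_eq_iff)
    qed
    ultimately show ?thesis
      using \<Omega> by (auto simp: reps_def orth_on_def local_gp_def N_def equilibrium_stress_matrix_def)
  qed
  then have "mat 1 \<in> closure (reps \<inter> {V. \<forall>L\<in>{L. card L = rank \<Omega>}. nonsing_on L V})"
    using all_nonsing_dense[of "{L. card L = rank \<Omega>}"] by auto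
  moreover have "open {V :: real^'n^'n. \<forall>x\<in>UNIV. V *v x = 0 \<longrightarrow> x = 0}"
    by (rule open_matrix_injective_on) simp
  ultimately have "mat 1 \<in> closure ({V. \<forall>x\<in>UNIV. V *v x = 0 \<longrightarrow> x = 0} \<inter>
      (reps \<inter> {V. \<forall>L\<in>{L. card L = rank \<Omega>}. nonsing_on L V}))"
    using open_Int_closure_subset by fastforce
  then obtain V where V: "\<And>k. V k \<in> {V. \<forall>x\<in>UNIV. V *v x = 0 \<longrightarrow> x = 0} \<inter>
      (reps \<inter> {V. \<forall>L\<in>{L. card L = rank \<Omega>}. nonsing_on L V})" and lim: "V \<longlonglongrightarrow> mat 1"
    unfolding closure_sequential by blast
  have inv: "invertible (V k)" for k
    using V[of k] by (auto simp: invertible_left_inverse matrix_left_invertible_ker)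
  then have "\<exists>W. V k ** W = mat 1" for k
    by (auto simp: invertible_def)
  then obtain W where W: "\<And>k. V k ** W k = mat 1" by metis
  have sol: "V k *v (W k *v y) = y" for k y
    by (simp add: matrix_vector_mul_assoc W)
  have lim_sol: "(\<lambda>k. W k *v y) \<longlonglongrightarrow> y" for y
    by (rule tendsto_solution_mat_1[OF lim sol])
  \<comment> \<open>\<open>W k\<close> carries the homogeneous coordinates of \<open>p\<close> to
    nearby ones with last coordinate \<open>s k\<close>. Dividing by it returns to affine
    coordinates.\<close>
  define s where "s k = W k *v (\<chi> i. 1)" for k
  define q :: "nat \<Rightarrow> real^'d^'n" where
    "q k = (\<chi> i. \<chi> a. (W k *v (\<chi> i. p $ i $ a)) $ i / s k $ i)" for k
  have lim_s: "(\<lambda>k. s k $ i) \<longlonglongrightarrow> 1" for i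
    using tendsto_vec_nth[OF lim_sol[of "\<chi> i. 1"], of i] by (simp add: s_def)
  have "q \<longlonglongrightarrow> (\<chi> i. \<chi> a. p $ i $ a / 1)"
    unfolding q_def
  proof (intro tendsto_vec_lambda tendsto_divide lim_s)
    fix i a
    show "(\<lambda>k. (W k *v (\<chi> i. p $ i $ a)) $ i) \<longlonglongrightarrow> p $ i $ a"
      using tendsto_vec_nth[OF lim_sol[of "\<chi> i. p $ i $ a"], of i] by simp
  qed simp
  then have "q \<longlonglongrightarrow> p" by (simp add: vec_lambda_eta)
  \<comment> \<open>Finitely many terms may have a zero entry in \<open>s k\<close>, where the
    division defaults to 0. Eventual membership is enough for the limit.\<close>
  moreover have "eventually (\<lambda>k. q k \<in> closure {q. Gstressable E q}) sequentially"
  proof -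
    have "eventually (\<lambda>k. \<forall>i. s k $ i > 0) sequentially"
      by (intro eventually_all_finite order_tendstoD(1)[OF lim_s]) simp
    then show ?thesis
    proof eventually_elim
      case (elim k)
      have "Gstressable E (q k)"
      proof (rule Gstressable_gram[OF N_def \<Omega> rank span inv, where s = "s k"])
        show s0: "s k $ i \<noteq> 0" for i using elim[rule_format, of i] by simp
        show "V k *v (\<chi> i. s k $ i * q k $ i $ a) = (\<chi> i. p $ i $ a)" for a
        proof -
          have "(\<chi> i. s k $ i * q k $ i $ a) = W k *v (\<chi> i. p $ i $ a)"
            by (simp add: q_def vec_eq_iff s0)
          then show ?thesis by (simp add: sol)
        qed
        show "orth_on UNIV (V k)"
          using V[of k] unfolding reps_def by blast
        show "nonsing_on L (V k)" if "card L = rank \<Omega>" for L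
          using V[of k] that by blast
        show "V k *v s k = (\<chi> i. 1)"
          by (simp only: s_def sol)
      qed
      then show ?case by (simp add: subsetD[OF closure_subset])
    qed
  qed
  ultimately show ?thesis
    using Lim_in_closed_set[OF closed_closure] trivial_limit_sequentially by blast
qed

theorem theorem6p2:
  fixes E :: "'n::finite set set"
  assumes "simple_graph E"
    and "CARD('n) \<ge> CARD('d::finite) + 2"
  shows "dense_in {p :: real^'d^'n. Gstressable E p} {p :: real^'d^'n. Fstressable E p}"
  unfolding dense_in_def
  using Gstressable_imp_Fstressable[OF assms(2)] Fstressable_imp_closure by blast

end
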